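(* Let $k\ge 5$ and let $(X,\mathcal{B})$ be a $(v,k,4,6)$ cover. For every $x\in X$ put $\mathcal{B}(x)=\{B\setminus\{x\} : B\in\mathcal{B},\ x\in B\}$, and choose $a\in X$ with $|\mathcal{B}(a)|\le|\mathcal{B}(x)|$ for all $x\in X$. Let $b,c,d$ be three new points not in $X$. Let $X_{1,1},X_{1,2},X_{2,1},X_{2,2},X_{3,1},X_{3,2}$ be a partition of $X\setminus\{a\}$. Take covering designs with $t=2$ as follows: $(X_{1,1}\cup X_{2,1},\mathcal{C}_1)$, $(X_{1,2}\cup X_{2,2},\mathcal{C}_2)$, $(X_{3,1}\cup X_{3,2},\mathcal{C}_3)$ with block size $k-3$; $(X_{1,1}\cup X_{2,2},\mathcal{D}_1)$, $(X_{1,2}\cup X_{2,1},\mathcal{D}_2)$, $(X_{3,1}\cup X_{3,2},\mathcal{D}_3)$ with block size $k-3$; and $(X_{1,1}\cup X_{1,2},\mathcal{E}_1)$, $(X_{2,1}\cup X_{2,2},\mathcal{E}_2)$, $(X_{3,1}\cup X_{3,2},\mathcal{E}_3)$ with block size $k-2$ (each is a covering design in which every pair of points of its point set lies in some block). Define $\mathcal{B}_1=\mathcal{B}$; $\mathcal{B}_2=\{B\cup\{p\}: B\in\mathcal{B}(a),\ p\in\{b,c,d\}\}$; $\mathcal{B}_3=\{C\cup\{a,b,c\}: C\in\bigcup_{i=1}^3\mathcal{C}_i\}$; $\mathcal{B}_4=\{D\cup\{a,b,d\}: D\in\bigcup_{i=1}^3\mathcal{D}_i\}$; $\mathcal{B}_5=\{E\cup\{c,d\}: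 E\in\bigcup_{i=1}^3\mathcal{E}_i\}$. Then $(X\cup\{b,c,d\},\bigcup_{i=1}^5\mathcal{B}_i)$ is a $(v+3,k,4,6)$ cover.
   Context: A $(v,k,t,m)$ cover (lotto design) is a pair $(X,\mathcal{B})$ where $X$ is a set of $v$ points and $\mathcal{B}$ is a collection of $k$-subsets of $X$ (blocks) such that every $m$-subset of $X$ meets at least one block in at least $t$ points. A $(v,k,t)$ covering design is a $(v,k,t,t)$ cover, i.e. every $t$-subset of $X$ is contained in some block. *)

theory Defs
  imports Main "HOL-Library.Disjoint_Sets"
begin

definition lotto_cover :: "nat \<Rightarrow> nat \<Rightarrow> nat \<Rightarrow> nat \<Rightarrow> 'a set \<Rightarrow> 'a set set \<Rightarrow> bool" where
  "lotto_cover v k t m X \<B> \<longleftrightarrow>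
     finite X \<and> card X = v \<and>
     (\<forall>B\<in>\<B>. B \<subseteq> X \<and> card B = k) \<and>
     (\<forall>S. S \<subseteq> X \<and> card S = m \<longrightarrow> (\<exists>B\<in>\<B>. card (S \<inter> B) \<ge> t))"

definition covering_design :: "nat \<Rightarrow> nat \<Rightarrow> nat \<Rightarrow> 'a set \<Rightarrow> 'a set set \<Rightarrow> bool" where
  "covering_design v k t X \<B> \<longleftrightarrow> lotto_cover v k t t X \<B>"

lemma covering_design_iff:
  "covering_design v k t X \<B> \<longleftrightarrow>
     finite X \<and> card X = v \<and>
     (\<forall>B\<in>\<B>. B \<subseteq> X \<and> card B = k) \<and>
     (\<forall>S. S \<subseteq> X \<and> card S = t \<longrightarrow> (\<exists>B\<in>\<B>. S \<subseteq> B))"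
proof -
  have *: "t \<le> card (S \<inter> B) \<longleftrightarrow> S \<subseteq> B" if fin: "finite X" and sub: "S \<subseteq> X" and card: "card S = t" for S B
  proof
    have "finite S" using fin sub finite_subset by blast
    moreover assume "t \<le> card (S \<inter> B)"
    ultimately have "S \<inter> B = S" by (intro card_seteq) (simp_all add: card)
    then show "S \<subseteq> B" by (simp add: Int_absorb2 inf.absorb_iff1)
  next
    assume "S \<subseteq> B"
    then have "S \<inter> B = S" by (rule Int_absorb2)
    then show "t \<le> card (S \<inter> B)" by (simp add: card)
  qed
  show ?thesis
    unfolding covering_design_def lotto_cover_def
    by (intro conj_cong refl all_cong1 imp_cong bex_cong) (simp_all add: *)
qed

definition derived_blocks :: "'a set set \<Rightarrow> 'a \<Rightarrow> 'a set set" where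
  "derived_blocks \<B> x = {B - {x} | B. B \<in> \<B> \<and> x \<in> B}"

end

theory Submission
  imports Defs
begin

text \<open>
  Let \<open>S\<close> be a 6-set of \<open>X \<union> {b, c, d}\<close> and \<open>Q = S - {a, b, c, d}\<close>.
  If \<open>S\<close> contains none of \<open>b, c, d\<close>, the original cover serves; if it contains exactly one of
  them but not \<open>a\<close>, replace that point by \<open>a\<close> and use the original or the derived blocks.
  Otherwise \<open>S\<close> contains at least two of \<open>a, b, c, d\<close>. If exactly two, then \<open>card Q = 4\<close> and by
  pigeonhole two points of \<open>Q\<close> share one of the three point sets of the family of designs attached
  to that pair. If at least three, then either \<open>S\<close> contains \<open>a, b\<close> and one of \<open>c, d\<close>, and any
  single point of \<open>Q\<close> will do (it lies in a block of the design, because nonempty disjoint parts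
  give every design at least two points), or \<open>S\<close> contains \<open>c, d\<close> and exactly one of \<open>a, b\<close>; then
  two of the three points of \<open>Q\<close> lie both in
  \<open>X31 \<union> X32\<close> or both in the union of the other four parts, and any two of these four parts
  are joined by one of the designs \<open>\<C>\<close>, \<open>\<D>\<close>, \<open>\<E>\<close>, each of which can be completed inside \<open>S\<close>.
\<close>

text \<open>Choosing for each point of \<open>Q\<close> a member of \<open>\<G>\<close> that
  contains it gives a map that cannot be injective; a collision supplies \<open>x\<close> and
  \<open>y\<close>. The members of \<open>\<G>\<close> may overlap.\<close>

lemma pigeonhole_cover:
  assumes "finite \<G>" and "Q \<subseteq> \<Union>\<G>" and "card \<G> < card Q"
  obtains G x y where "G \<in> \<G>" "x \<in> Q \<inter> G" "y \<in> Q \<inter> G" "x \<noteq> y"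
proof -
  obtain f where f: "\<And>x. x \<in> Q \<Longrightarrow> f x \<in> \<G> \<and> x \<in> f x"
    using assms(2) bchoice[of Q "\<lambda>x G. G \<in> \<G> \<and> x \<in> G"] by blast
  have "card (f ` Q) \<le> card \<G>"
    using f assms(1) by (intro card_mono) auto
  then have "\<not> inj_on f Q"
    using assms(3) pigeonhole[of f Q] by simp
  then obtain x y where "x \<in> Q" "y \<in> Q" "x \<noteq> y" "f x = f y"
    unfolding inj_on_def by blast
  with f show thesis
    by (intro that[of "f x" x y]) (metis IntI)+
qed

lemma covering_design_pair:
  assumes "covering_design n k 2 Y \<C>" and "x \<in> Y" "y \<in> Y" "x \<noteq> y"
  shows "\<exists>B\<in>\<C>. x \<in> B \<and> y \<in> B"
proof -
  have "{x, y} \<subseteq> Y \<and> card {x, y} = 2"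
    using assms by simp
  then show ?thesis
    using assms(1) unfolding covering_design_iff by (metis insert_subset)
qed

lemma covering_designs_pigeonhole:
  assumes "covering_design n1 k 2 Y1 \<C>1" and "covering_design n2 k 2 Y2 \<C>2"
    and "covering_design n3 k 2 Y3 \<C>3"
    and "Q \<subseteq> Y1 \<union> Y2 \<union> Y3" and "4 \<le> card Q"
  shows "\<exists>B\<in>\<C>1 \<union> \<C>2 \<union> \<C>3. \<exists>x\<in>Q. \<exists>y\<in>Q. x \<in> B \<and> y \<in> B \<and> x \<noteq> y"
proof -
  \<comment> \<open>Only an upper bound: nothing here prevents the point sets from
    coinciding.\<close>
  have "card {Y1, Y2, Y3} \<le> 3"
    by (simp add: card_insert_if)
  then obtain G x y where "G \<in> {Y1, Y2, Y3}" "x \<in> Q \<inter> G" "y \<in> Q \<inter> G" "x \<noteq> y"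
    using assms(4,5) by (elim pigeonhole_cover[of "{Y1, Y2, Y3}" Q, rotated 3]) auto
  then have "\<exists>B\<in>\<C>1 \<union> \<C>2 \<union> \<C>3. x \<in> B \<and> y \<in> B"
    using covering_design_pair[OF assms(1), of x y] covering_design_pair[OF assms(2), of x y]
      covering_design_pair[OF assms(3), of x y] by blast
  with \<open>x \<in> Q \<inter> G\<close> \<open>y \<in> Q \<inter> G\<close> \<open>x \<noteq> y\<close> show ?thesis
    by blast
qed

text \<open>With \<open>t = 2\<close> blocks are promised only for pairs. Two nonempty disjoint
  parts ensure a second point \<open>y\<close>, and a block through \<open>x\<close> and
  \<open>y\<close> serves for \<open>x\<close> alone.\<close>

lemma covering_design_disjoint_union_point:
  assumes "covering_design n k 2 (Y \<union> Z) \<C>"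
    and "Y \<noteq> {}" "Z \<noteq> {}" "Y \<inter> Z = {}" and "x \<in> Y \<union> Z"
  shows "\<exists>B\<in>\<C>. x \<in> B"
proof -
  obtain y where "y \<in> Y \<union> Z" "y \<noteq> x"
    using assms(2-5) by blast
  then show ?thesis
    using covering_design_pair[OF assms(1)] assms(5) by metis
qed

lemma four_le_card:
  assumes "finite A" and "{p, q, r, s} \<subseteq> A" and "distinct [p, q, r, s]"
  shows "4 \<le> card A"
proof -
  have "card {p, q, r, s} = 4"
    using assms(3) by simp
  then show ?thesis
    using card_mono[OF assms(1,2)] by simp
qed

theorem theorem12:
  fixes v k :: nat
    and X X11 X12 X21 X22 X31 X32 :: "'a set"
    and \<B> \<B>1 \<B>2 \<B>3 \<B>4 \<B>5 \<C>1 \<C>2 \<C>3 \<D>1 \<D>2 \<D>3 \<E>1 \<E>2 \<E>3 :: "'a set set"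
    and a b c d :: 'a
  assumes "k \<ge> 5"
    and "lotto_cover v k 4 6 X \<B>"
    and "a \<in> X"
    and "\<forall>x\<in>X. card (derived_blocks \<B> a) \<le> card (derived_blocks \<B> x)"
    and "distinct [b, c, d]" and "b \<notin> X" and "c \<notin> X" and "d \<notin> X"
    and "partition_on (X - {a}) {X11, X12, X21, X22, X31, X32}"
    and "distinct [X11, X12, X21, X22, X31, X32]"
    and "covering_design (card (X11 \<union> X21)) (k - 3) 2 (X11 \<union> X21) \<C>1"
    and "covering_design (card (X12 \<union> X22)) (k - 3) 2 (X12 \<union> X22) \<C>2"
    and "covering_design (card (X31 \<union> X32)) (k - 3) 2 (X31 \<union> X32) \<C>3"
    and "covering_design (card (X11 \<union> X22)) (k - 3) 2 (X11 \<union> X22) \<D>1"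
    and "covering_design (card (X12 \<union> X21)) (k - 3) 2 (X12 \<union> X21) \<D>2"
    and "covering_design (card (X31 \<union> X32)) (k - 3) 2 (X31 \<union> X32) \<D>3"
    and "covering_design (card (X11 \<union> X12)) (k - 2) 2 (X11 \<union> X12) \<E>1"
    and "covering_design (card (X21 \<union> X22)) (k - 2) 2 (X21 \<union> X22) \<E>2"
    and "covering_design (card (X31 \<union> X32)) (k - 2) 2 (X31 \<union> X32) \<E>3"
    and "\<B>1 = \<B>"
    and "\<B>2 = {B \<union> {p} | B p. B \<in> derived_blocks \<B> a \<and> p \<in> {b, c, d}}"
    and "\<B>3 = {C \<union> {a, b, c} | C. C \<in> \<C>1 \<union> \<C>2 \<union> \<C>3}"
    and "\<B>4 = {D \<union> {a, b, d} | D. D \<in> \<D>1 \<union> \<D>2 \<union> \<D>3}"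
    and "\<B>5 = {E \<union> {c, d} | E. E \<in> \<E>1 \<union> \<E>2 \<union> \<E>3}"
  shows "lotto_cover (v + 3) k 4 6 (X \<union> {b, c, d}) (\<B>1 \<union> \<B>2 \<union> \<B>3 \<union> \<B>4 \<union> \<B>5)"
proof -
  let ?\<C> = "\<C>1 \<union> \<C>2 \<union> \<C>3" and ?\<D> = "\<D>1 \<union> \<D>2 \<union> \<D>3" and ?\<E> = "\<E>1 \<union> \<E>2 \<union> \<E>3"
  let ?F = "\<B>1 \<union> \<B>2 \<union> \<B>3 \<union> \<B>4 \<union> \<B>5"
  note k = assms(1) and cover = assms(2) and aX = assms(3)
    and new = assms(5-8) and part = assms(9) and dist = assms(10)
    and C = assms(11-13) and D = assms(14-16) and E = assms(17-19)
    and blocks = assms(20-24)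
  have finX: "finite X" and cardX: "card X = v"
    and \<B>: "\<And>B. B \<in> \<B> \<Longrightarrow> B \<subseteq> X \<and> card B = k"
    and cover_ex: "\<And>S. S \<subseteq> X \<Longrightarrow> card S = 6 \<Longrightarrow> \<exists>B\<in>\<B>. 4 \<le> card (S \<inter> B)"
    using cover unfolding lotto_cover_def by blast+
  have abcd: "distinct [a, b, c, d]"
    using new aX by auto
  have X_eq: "X - {a} = X11 \<union> X12 \<union> X21 \<union> X22 \<union> X31 \<union> X32"
    using partition_onD1[OF part] by auto
  have nonempty: "X11 \<noteq> {}" "X12 \<noteq> {}" "X21 \<noteq> {}" "X22 \<noteq> {}" "X31 \<noteq> {}" "X32 \<noteq> {}"
    using partition_onD3[OF part] by auto
  \<comment> \<open>The partition is given as a set, so \<open>dist\<close> is needed to make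
    differently named parts disjoint. The listed pairs are those joined in the families
    \<open>\<C>\<close> and \<open>\<D>\<close>.\<close>
  have disj: "X11 \<inter> X21 = {}" "X12 \<inter> X22 = {}" "X31 \<inter> X32 = {}" "X11 \<inter> X22 = {}" "X12 \<inter> X21 = {}"
    using disjointD[OF partition_onD2[OF part]] dist by simp_all

  \<comment> \<open>Point sets and sizes of the blocks\<close>
  have CD_sub: "B \<subseteq> X - {a} \<and> card B = k - 3" if "B \<in> ?\<C> \<union> ?\<D>" for B
    using that C D unfolding covering_design_iff X_eq by (elim UnE) auto
  have E_sub: "B \<subseteq> X - {a} \<and> card B = k - 2" if "B \<in> ?\<E>" for B
    using that E unfolding covering_design_iff X_eq by (elim UnE) auto

  have block: "B \<subseteq> X \<union> {b, c, d} \<and> card B = k" if B: "B \<in> ?F" for B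
  proof -
    consider "B \<in> \<B>" | "B \<in> \<B>2" | "B \<in> \<B>3 \<union> \<B>4" | "B \<in> \<B>5"
      using B blocks(1) by blast
    then show ?thesis
    proof cases
      case 1
      then show ?thesis using \<B> by blast
    next
      case 2
      then obtain A p where A: "B = A - {a} \<union> {p}" "A \<in> \<B>" "a \<in> A" "p \<in> {b, c, d}"
        unfolding blocks(2) derived_blocks_def by blast
      have "finite A" "p \<notin> A"
        using \<B>[OF A(2)] finite_subset[OF _ finX] A(4) new by auto
      then have "card B = k"
        using \<B>[OF A(2)] A(1,3) k by simp
      then show ?thesis
        using \<B>[OF A(2)] A(1,4) by auto
    next
      case 3
      then obtain A q where A: "B = A \<union> {a, b, q}" "A \<in> ?\<C> \<union> ?\<D>" "q \<in> {c, d}"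
        unfolding blocks(3,4) by blast
      have "finite A" "a \<notin> A" "b \<notin> A" "q \<notin> A" "distinct [a, b, q]"
        using CD_sub[OF A(2)] finite_subset[OF _ finX] A(3) new abcd by auto
      \<comment> \<open>The bound on \<open>k\<close> makes the natural-number subtraction
        \<open>k - 3\<close> exact, so three added points restore size \<open>k\<close>.\<close>
      then have "card B = k"
        using CD_sub[OF A(2)] A(1) k by simp
      then show ?thesis
        using CD_sub[OF A(2)] A(1,3) aX by auto
    next
      case 4
      then obtain A where A: "B = A \<union> {c, d}" "A \<in> ?\<E>"
        unfolding blocks(5) by blast
      have "finite A" "c \<notin> A" "d \<notin> A"
        using E_sub[OF A(2)] finite_subset[OF _ finX] new by auto
      then have "card B = k"
        using E_sub[OF A(2)] A(1) k abcd by simp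
      then show ?thesis
        using E_sub[OF A(2)] A(1) by auto
    qed
  qed

  \<comment> \<open>The covering property: six-sets with several of
    \<open>a, b, c, d\<close>\<close>
  have meet: "\<exists>B\<in>?F. 4 \<le> card (S \<inter> B)" if S: "S \<subseteq> X \<union> {b, c, d}" and cardS: "card S = 6" for S
  proof -
    define Q where "Q = S - {a, b, c, d}"
    have finS: "finite S"
      using cardS card.infinite by fastforce
    have Q_sub: "Q \<subseteq> X - {a}" "Q \<subseteq> S"
      using S unfolding Q_def by auto
    have Q_new: "a \<notin> Q" "b \<notin> Q" "c \<notin> Q" "d \<notin> Q"
      unfolding Q_def by auto
    have "card Q + card (S \<inter> {a, b, c, d}) = 6"
      using card_Diff_subset_Int[of S "{a, b, c, d}"] card_mono[OF finS, of "S \<inter> {a, b, c, d}"]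
        cardS unfolding Q_def by simp
    \<comment> \<open>Indicators turn the count into a linear equation, so each of the sixteen
      membership patterns determines \<open>card Q\<close>.\<close>
    then have cardQ: "card Q + of_bool (a \<in> S) + of_bool (b \<in> S) + of_bool (c \<in> S)
        + of_bool (d \<in> S) = 6"
      using abcd by (auto simp: Int_insert_right of_bool_def split: if_splits)

    have four: "\<exists>B\<in>?F. 4 \<le> card (S \<inter> B)"
      if "B \<in> ?F" "{p, q, r, s} \<subseteq> S \<inter> B" "distinct [p, q, r, s]" for B p q r s
      using four_le_card[OF _ that(2,3)] finS that(1) by blast
    have C_in: "B \<union> {a, b, c} \<in> ?F" if "B \<in> ?\<C>" for B
      using that unfolding blocks by blast
    have D_in: "B \<union> {a, b, d} \<in> ?F" if "B \<in> ?\<D>" for B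
      using that unfolding blocks by blast
    have E_in: "B \<union> {c, d} \<in> ?F" if "B \<in> ?\<E>" for B
      using that unfolding blocks by blast

    \<comment> \<open>The pair \<open>x, y\<close> comes from the design block and
      \<open>p, q\<close> from the points attached to it; \<open>Q\<close> avoids
      \<open>a, b, c, d\<close>, so the four are distinct.\<close>
    have C_pair: ?thesis
      if "B \<in> ?\<C>" "{x, y} \<subseteq> Q \<inter> B" "x \<noteq> y" "{p, q} \<subseteq> S \<inter> {a, b, c}" "p \<noteq> q" for B x y p q
      using that Q_sub Q_new by (intro four[OF C_in[OF that(1)], of p q x y]) auto
    have D_pair: ?thesis
      if "B \<in> ?\<D>" "{x, y} \<subseteq> Q \<inter> B" "x \<noteq> y" "{p, q} \<subseteq> S \<inter> {a, b, d}" "p \<noteq> q" for B x y p q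
      using that Q_sub Q_new by (intro four[OF D_in[OF that(1)], of p q x y]) auto
    have E_pair: ?thesis
      if "B \<in> ?\<E>" "{x, y} \<subseteq> Q \<inter> B" "x \<noteq> y" "{c, d} \<subseteq> S" for B x y
      using that Q_sub Q_new abcd by (intro four[OF E_in[OF that(1)], of c d x y]) auto

    \<comment> \<open>The three point sets within each family together exhaust
      \<open>X - {a}\<close>, hence cover \<open>Q\<close>.\<close>
    have C4: ?thesis if "4 \<le> card Q" "{p, q} \<subseteq> S \<inter> {a, b, c}" "p \<noteq> q" for p q
      using covering_designs_pigeonhole[OF C _ that(1)] C_pair[OF _ _ _ that(2,3)]
        Q_sub unfolding X_eq by blast
    have D4: ?thesis if "4 \<le> card Q" "{p, q} \<subseteq> S \<inter> {a, b, d}" "p \<noteq> q" for p q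
      using covering_designs_pigeonhole[OF D _ that(1)] D_pair[OF _ _ _ that(2,3)]
        Q_sub unfolding X_eq by blast
    have E4: ?thesis if "4 \<le> card Q" "{c, d} \<subseteq> S"
      using covering_designs_pigeonhole[OF E _ that(1)] E_pair[OF _ _ _ that(2)]
        Q_sub unfolding X_eq by blast

    have abx: ?thesis if abx: "0 < card Q" "{a, b} \<subseteq> S" "c \<in> S \<or> d \<in> S"
    proof -
      obtain x where x: "x \<in> Q"
        using abx(1) by fastforce
      then have "x \<in> X11 \<union> X12 \<union> X21 \<union> X22 \<union> X31 \<union> X32"
        using Q_sub X_eq by blast
      \<comment> \<open>Both families are needed: \<open>\<C>\<close> serves when
        \<open>c \<in> S\<close>, \<open>\<D>\<close> when \<open>d \<in> S\<close>.\<close>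
      then have "\<exists>B\<in>?\<C>. x \<in> B" and "\<exists>B\<in>?\<D>. x \<in> B"
        using covering_design_disjoint_union_point[OF C(1), of x]
          covering_design_disjoint_union_point[OF C(2), of x]
          covering_design_disjoint_union_point[OF C(3), of x]
          covering_design_disjoint_union_point[OF D(1), of x]
          covering_design_disjoint_union_point[OF D(2), of x]
          covering_design_disjoint_union_point[OF D(3), of x] nonempty disj by blast+
      then obtain B B' where B: "B \<in> ?\<C>" "x \<in> B" and B': "B' \<in> ?\<D>" "x \<in> B'"
        by blast
      from abx(3) show ?thesis
      proof
        assume "c \<in> S"
        then show ?thesis
          using B x abx(2) Q_sub Q_new abcd by (intro four[OF C_in[OF B(1)], of a b c x]) auto
      next
        assume "d \<in> S"
        then show ?thesis
          using B' x abx(2) Q_sub Q_new abcd by (intro four[OF D_in[OF B'(1)], of a b d x]) auto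
      qed
    qed

    have ucd: ?thesis if ucd: "3 \<le> card Q" "{u, c, d} \<subseteq> S" "u \<in> {a, b}" for u
    proof -
      let ?G = "{X31 \<union> X32, X11 \<union> X12 \<union> X21 \<union> X22}"
      have "card ?G \<le> 2"
        by (simp add: card_insert_if)
      then obtain G x y where xy: "G \<in> ?G" "x \<in> Q \<inter> G" "y \<in> Q \<inter> G" "x \<noteq> y"
        using ucd(1) Q_sub X_eq by (elim pigeonhole_cover[of ?G Q, rotated 3]) auto
      \<comment> \<open>Besides \<open>X31 \<union> X32\<close>, the list consists of the three ways
        to split the first four parts into two pairs, one way per family. Every two of these parts
        therefore occur together, and two points of a single part are covered too.\<close>
      then have "\<exists>Y\<in>{X31 \<union> X32, X11 \<union> X21, X12 \<union> X22, X11 \<union> X22, X12 \<union> X21, X11 \<union> X12,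
          X21 \<union> X22}. x \<in> Y \<and> y \<in> Y"
        by auto
      then obtain Y where Y: "x \<in> Y" "y \<in> Y" "Y \<in> {X31 \<union> X32, X11 \<union> X21, X12 \<union> X22,
          X11 \<union> X22, X12 \<union> X21, X11 \<union> X12, X21 \<union> X22}"
        by (elim bexE conjE)
      have "\<exists>B\<in>?\<C> \<union> ?\<D> \<union> ?\<E>. x \<in> B \<and> y \<in> B"
        using Y(3) covering_design_pair[OF _ Y(1,2) xy(4)] C(1,2,3) D(1,2) E(1,2)
        by (elim insertE emptyE) (metis UnCI)+
      then obtain B where B: "B \<in> ?\<C> \<union> ?\<D> \<union> ?\<E>" "{x, y} \<subseteq> Q \<inter> B"
        using xy(2,3) by blast
      \<comment> \<open>Whichever family \<open>B\<close> belongs to, two of its attached points lie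
        in \<open>S\<close>: \<open>u, c\<close> for \<open>\<C>\<close>, \<open>u, d\<close> for
        \<open>\<D>\<close>, \<open>c, d\<close> for \<open>\<E>\<close>.\<close>
      have u: "{u, c} \<subseteq> S \<inter> {a, b, c}" "u \<noteq> c" "{u, d} \<subseteq> S \<inter> {a, b, d}" "u \<noteq> d" "{c, d} \<subseteq> S"
        using ucd(2,3) abcd by auto
      from B(1) consider "B \<in> ?\<C>" | "B \<in> ?\<D>" | "B \<in> ?\<E>"
        by blast
      then show ?thesis
        using C_pair[OF _ B(2) xy(4) u(1,2)] D_pair[OF _ B(2) xy(4) u(3,4)]
          E_pair[OF _ B(2) xy(4) u(5)] by cases
    qed

    \<comment> \<open>Six-sets with at most one new point\<close>
    have old: ?thesis if "b \<notin> S" "c \<notin> S" "d \<notin> S"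
    proof -
      have "S \<subseteq> X"
        using S that by blast
      then show ?thesis
        using cover_ex[OF _ cardS] blocks(1) by blast
    qed
    have one_new: ?thesis if p: "a \<notin> S" "p \<in> S" "p \<in> {b, c, d}" "{b, c, d} \<inter> S \<subseteq> {p}" for p
    proof -
      have sub: "S - {p} \<subseteq> X"
        using S p(4) by blast
      \<comment> \<open>Exchanging \<open>p\<close> for the absent point \<open>a\<close> gives a
        six-set inside \<open>X\<close>, to which the original cover applies.\<close>
      have "card (insert a (S - {p})) = 6"
        using p(1,2) finS cardS by simp
      then obtain B where B: "B \<in> \<B>" "4 \<le> card (insert a (S - {p}) \<inter> B)"
        using cover_ex[of "insert a (S - {p})"] sub aX by auto
      show ?thesis
      proof (cases "a \<in> B")
        case True
        have "p \<notin> B"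
          using \<B>[OF B(1)] p(3) new by blast
        \<comment> \<open>The same exchange in the block: \<open>p\<close> now counts in place of
          \<open>a\<close>, and the size of the intersection is unchanged.\<close>
        then have "insert a (S - {p}) \<inter> B = insert a (S \<inter> B)"
          and "S \<inter> (B - {a} \<union> {p}) = insert p (S \<inter> B)"
          using True p(1,2) by auto
        then have "4 \<le> card (S \<inter> (B - {a} \<union> {p}))"
          using B(2) finS p(1) \<open>p \<notin> B\<close> by simp
        moreover have "B - {a} \<union> {p} \<in> \<B>2"
          using B(1) True p(3) unfolding blocks(2) derived_blocks_def by blast
        ultimately show ?thesis
          by blast
      next
        case False
        \<comment> \<open>Here \<open>a\<close> contributes nothing to the intersection, so
          \<open>B\<close> itself already meets \<open>S\<close> in four points.\<close>
        then have "insert a (S - {p}) \<inter> B \<subseteq> S \<inter> B"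
          by blast
        then have "4 \<le> card (S \<inter> B)"
          using B(2) card_mono[of "S \<inter> B"] finS by (meson finite_Int le_trans)
        then show ?thesis
          using B(1) blocks(1) by blast
      qed
    qed

    have one_b: ?thesis if "a \<notin> S" "b \<in> S" "c \<notin> S" "d \<notin> S"
      by (rule one_new[of b]) (use that in auto)
    have one_c: ?thesis if "a \<notin> S" "b \<notin> S" "c \<in> S" "d \<notin> S"
      by (rule one_new[of c]) (use that in auto)
    have one_d: ?thesis if "a \<notin> S" "b \<notin> S" "c \<notin> S" "d \<in> S"
      by (rule one_new[of d]) (use that in auto)

    \<comment> \<open>The three alternatives account for all six pairs from
      \<open>a, b, c, d\<close>; \<open>{a, b}\<close> falls under two of them.\<close>
    have two: ?thesis
      if "4 \<le> card Q" "p \<in> S" "q \<in> S" "p \<noteq> q" "{p, q} \<subseteq> {a, b, c} \<or> {p, q} \<subseteq> {a, b, d} \<or> {p, q} = {c, d}"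
      for p q
      using that(5)
    proof (elim disjE)
      assume "{p, q} \<subseteq> {a, b, c}"
      then show ?thesis
        using that(2,3) by (intro C4[OF that(1) _ that(4)]) blast
    next
      assume "{p, q} \<subseteq> {a, b, d}"
      then show ?thesis
        using that(2,3) by (intro D4[OF that(1) _ that(4)]) blast
    next
      assume "{p, q} = {c, d}"
      then show ?thesis
        using that(2,3) by (intro E4[OF that(1)]) (auto simp: doubleton_eq_iff)
    qed

    \<comment> \<open>The cases may overlap. A triple from \<open>a, b, c, d\<close> containing
      \<open>a, b\<close> and the full quadruple go to the eleventh, the other two triples to the
      twelfth with \<open>u\<close> the one of \<open>a, b\<close> in \<open>S\<close>.\<close>
    consider "b \<notin> S" "c \<notin> S" "d \<notin> S"
      | "a \<notin> S" "b \<in> S" "c \<notin> S" "d \<notin> S"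
      | "a \<notin> S" "b \<notin> S" "c \<in> S" "d \<notin> S"
      | "a \<notin> S" "b \<notin> S" "c \<notin> S" "d \<in> S"
      | "4 \<le> card Q" "a \<in> S" "b \<in> S" | "4 \<le> card Q" "a \<in> S" "c \<in> S"
      | "4 \<le> card Q" "a \<in> S" "d \<in> S" | "4 \<le> card Q" "b \<in> S" "c \<in> S"
      | "4 \<le> card Q" "b \<in> S" "d \<in> S" | "4 \<le> card Q" "c \<in> S" "d \<in> S"
      | "a \<in> S" "b \<in> S" "c \<in> S \<or> d \<in> S"
      | u where "3 \<le> card Q" "u \<in> S" "c \<in> S" "d \<in> S" "u \<in> {a, b}"
      using cardQ by (cases "a \<in> S"; cases "b \<in> S"; cases "c \<in> S"; cases "d \<in> S") simp_all
    then show ?thesis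
    proof cases
      case 1
      then show ?thesis by (rule old)
    next
      case 2
      then show ?thesis by (rule one_b)
    next
      case 3
      then show ?thesis by (rule one_c)
    next
      case 4
      then show ?thesis by (rule one_d)
    next
      case 5
      then show ?thesis by (rule two) (use abcd in auto)
    next
      case 6
      then show ?thesis by (rule two) (use abcd in auto)
    next
      case 7
      then show ?thesis by (rule two) (use abcd in auto)
    next
      case 8
      then show ?thesis by (rule two) (use abcd in auto)
    next
      case 9
      then show ?thesis by (rule two) (use abcd in auto)
    next
      case 10
      then show ?thesis by (rule two) (use abcd in auto)
    next
      case 11
      \<comment> \<open>At most four of the six points of \<open>S\<close> are outside
        \<open>Q\<close>.\<close>
      moreover have "0 < card Q"
        using cardQ by (auto simp: of_bool_def split: if_splits)
      ultimately show ?thesis by (intro abx) simp_all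
    next
      case 12
      then show ?thesis by (intro ucd[of u]) simp_all
    qed
  qed

  show ?thesis
    unfolding lotto_cover_def
  proof (intro conjI ballI allI impI)
    show "finite (X \<union> {b, c, d})" "card (X \<union> {b, c, d}) = v + 3"
      using finX cardX new by simp_all
  qed (use block meet in simp_all)
qed

end
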